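(* Let $(\Omega,\Sigma,P)$ be a probability space and let $\sigma\in L^1(0,1)$ be a spectral density with associated spectral risk measure $\mathcal{R}_\sigma$. For any $Y\in L^\infty$, $$\mathcal{R}_\sigma(Y)=\inf_f\ \left(\mathbb{E}\,f(Y)+\int_0^1f^*(\sigma(p))\,\mathrm{d}p\right),$$ where the infimum is among all arbitrary, measurable functions $f\colon\mathbb{R}\to\mathbb{R}$ and $f^*$ is the convex conjugate function of $f$.
   Context: Probability spaces may have atoms. For a real random variable $Y$, $F_Y^{-1}(\alpha):=\inf\{y\colon P(Y\le y)\ge\alpha\}$ is the left-continuous quantile. A spectral density (spectrum) is a non-decreasing function $\sigma\in L^1(0,1)$ with $\sigma\ge0$ and $\int_0^1\sigma(u)\,\mathrm{d}u=1$. The spectral risk measure with spectrum $\sigma$ is $\mathcal{R}_\sigma(Y):=\int_0^1F_Y^{-1}(\alpha)\,\sigma(\alpha)\,\mathrm{d}\alpha$. The convex conjugate of $f\colon\mathbb{R}\to\mathbb{R}$ is $f^*(y):=\sup_{x\in\mathbb{R}}\,(x\cdot y-f(x))$, which may evaluate to $+\infty$. Convention: the objective $\mathbb{E}f(Y)+\int_0^1f^*(\sigma(p))\,\mathrm{d}p$ is read as $+\infty$ whenever $\int_0^1f^*(\sigma(p))\,\mathrm{d}p=+\infty$. *)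

theory Defs
  imports "HOL-Probability.Probability"
begin

definition spectral_density :: "(real \<Rightarrow> real) \<Rightarrow> bool" where
  "spectral_density \<sigma> \<longleftrightarrow>
     mono_on {0<..<1} \<sigma> \<and>
     (\<forall>u\<in>{0<..<1}. 0 \<le> \<sigma> u) \<and>
     set_integrable lborel {0<..<1} \<sigma> \<and>
     (LBINT u:{0<..<1}. \<sigma> u) = 1"

text \<open>Only used for \<open>0 < \<alpha> < 1\<close>, where the set below is non-empty and bounded below.\<close>

definition quantile :: "'a measure \<Rightarrow> ('a \<Rightarrow> real) \<Rightarrow> real \<Rightarrow> real" where
  "quantile M Y \<alpha> = Inf {y. \<P>(\<omega> in M. Y \<omega> \<le> y) \<ge> \<alpha>}"

definition spectral_risk :: "'a measure \<Rightarrow> (real \<Rightarrow> real) \<Rightarrow> ('a \<Rightarrow> real) \<Rightarrow> real" where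
  "spectral_risk M \<sigma> Y = (LBINT \<alpha>:{0<..<1}. quantile M Y \<alpha> * \<sigma> \<alpha>)"

definition convex_conjugate :: "(real \<Rightarrow> real) \<Rightarrow> real \<Rightarrow> ereal" where
  "convex_conjugate f y = (SUP x. ereal (x * y - f x))"

text \<open>
  The Lebesgue integral of an extended real function as the integral of its positive part minus
  the integral of its negative part (\<^const>\<open>e2ennreal\<close> sends negative arguments to \<open>0\<close>).  Unlike
  the Bochner integral, it keeps the values \<open>\<infinity>\<close> and \<open>-\<infinity>\<close>.
\<close>

definition ext_integral :: "'a measure \<Rightarrow> ('a \<Rightarrow> ereal) \<Rightarrow> ereal" where
  "ext_integral M g =
     enn2ereal (\<integral>\<^sup>+ x. e2ennreal (g x) \<partial>M) - enn2ereal (\<integral>\<^sup>+ x. e2ennreal (- g x) \<partial>M)"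

text \<open>
  The conjugate is bounded below by \<open>- f 0\<close>, so its integral is never \<open>-\<infinity>\<close>.  If that integral is
  finite, then \<open>f\<close> has an affine minorant, so for essentially bounded \<open>Y\<close> the negative part of
  \<open>f (Y \<omega>)\<close> is integrable.  Hence no undetermined \<open>\<infinity> - \<infinity>\<close> arises in the second branch.
\<close>

definition conjugate_objective ::
    "'a measure \<Rightarrow> (real \<Rightarrow> real) \<Rightarrow> ('a \<Rightarrow> real) \<Rightarrow> (real \<Rightarrow> real) \<Rightarrow> ereal" where
  "conjugate_objective M \<sigma> Y f =
     (let J = ext_integral (restrict_space lborel {0<..<1}) (\<lambda>p. convex_conjugate f (\<sigma> p))
      in if J = \<infinity> then \<infinity> else ext_integral M (\<lambda>\<omega>. ereal (f (Y \<omega>))) + J)"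

end

theory Submission
  imports Defs
begin

text \<open>
  Let \<open>q\<close> be the quantile function of \<open>Y\<close>. Under Lebesgue measure on the unit interval \<open>q\<close> has
  the distribution of \<open>Y\<close>, so that the expectation of \<open>f (Y)\<close> is the integral of \<open>f (q p)\<close>.
  This holds for spaces with atoms too. Everything then happens on \<open>(0, 1)\<close>.

  \<^bold>\<open>The risk measure is a lower bound.\<close> Integrate the Young inequality
  \<open>q p * \<sigma> p \<le> f (q p) + f\<^sup>* (\<sigma> p)\<close>
  (\<open>integral_le_ext_integral_conjugate\<close>). The work lies in the infinite values: if the integral of
  the conjugate is finite, then the inequality makes the negative part of \<open>f (q p)\<close> integrable.

  \<^bold>\<open>The bound is approached.\<close> Equality in the Young inequality requires \<open>\<sigma> p\<close> to be a
  subgradient of \<open>f\<close> at \<open>q p\<close>. As \<open>\<sigma>\<close> is monotone, this suggests a primitive of \<open>\<sigma> \<circ> F\<close>, where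
  \<open>F\<close> is the distribution function of \<open>Y\<close>. If \<open>\<sigma>\<close> is unbounded, two things can go wrong: the
  primitive may be infinite at the essential supremum of \<open>Y\<close>, and the conjugate of a real-valued \<open>f\<close>
  is finite at arbitrarily large slopes only if \<open>f\<close> grows superlinearly to the right. So \<open>\<sigma>\<close> is
  truncated at a high level, and to the right of a bound \<open>C\<close> of \<open>\<bar>Y\<bar>\<close>, where \<open>f\<close> does not affect the
  expectation, a step function with fast growing values \<open>H k\<close> is added. The error in the Young
  inequality is then at most the sum over \<open>k\<close> of the positive parts of \<open>(2 * C + k) * \<sigma> p - H k\<close>
  (\<open>convex_conjugate_primitive_with_penalty_le\<close>); the term \<open>k = 0\<close> pays for the truncation.
  Since \<open>\<sigma>\<close> is integrable, the \<open>H k\<close> can be chosen so that the integral of this sum is arbitrarily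
  small (\<open>truncated_tail_small\<close>).
\<close>

section \<open>The extended integral\<close>

lemma ext_integral_cong_AE:
  assumes "AE x in N. g x = h x"
  shows "ext_integral N g = ext_integral N h"
proof -
  have "(\<integral>\<^sup>+ x. e2ennreal (g x) \<partial>N) = (\<integral>\<^sup>+ x. e2ennreal (h x) \<partial>N)"
    by (rule nn_integral_cong_AE) (use assms in auto)
  moreover have "(\<integral>\<^sup>+ x. e2ennreal (- g x) \<partial>N) = (\<integral>\<^sup>+ x. e2ennreal (- h x) \<partial>N)"
    by (rule nn_integral_cong_AE) (use assms in auto)
  ultimately show ?thesis by (simp add: ext_integral_def)
qed

lemma ext_integral_ereal:
  fixes r :: "'a \<Rightarrow> real"
  assumes r: "integrable N r"
  shows "ext_integral N (\<lambda>x. ereal (r x)) = ereal (\<integral>x. r x \<partial>N)"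
proof -
  define a b where "a = (\<integral>\<^sup>+ x. ennreal (r x) \<partial>N)" and "b = (\<integral>\<^sup>+ x. ennreal (- r x) \<partial>N)"
  have "a \<noteq> \<infinity>" "b \<noteq> \<infinity>"
    using r unfolding a_def b_def real_integrable_def by auto
  then have "enn2ereal a = ereal (enn2real a)" "enn2ereal b = ereal (enn2real b)"
    by (cases a; cases b; simp add: enn2ereal_ennreal)+
  then show ?thesis
    unfolding ext_integral_def real_lebesgue_integral_def[OF r]
    by (simp add: a_def b_def)
qed

lemma ext_integral_distr:
  assumes [measurable]: "T \<in> measurable M N" "g \<in> borel_measurable N"
  shows "ext_integral (distr M N T) g = ext_integral M (\<lambda>x. g (T x))"
  unfolding ext_integral_def by (simp add: nn_integral_distr)

text \<open>If both parts have finite integral, the extended integral is a Bochner integral.\<close>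

lemma ext_integral_real_representative:
  assumes [measurable]: "g \<in> borel_measurable N"
    and pos: "(\<integral>\<^sup>+ x. e2ennreal (g x) \<partial>N) < \<infinity>"
    and neg: "(\<integral>\<^sup>+ x. e2ennreal (- g x) \<partial>N) < \<infinity>"
  obtains r where "integrable N r" "AE x in N. g x = ereal (r x)"
    "ext_integral N g = ereal (\<integral>x. r x \<partial>N)"
proof -
  define r where "r x = real_of_ereal (g x)" for x
  have [measurable]: "r \<in> borel_measurable N"
    unfolding r_def by measurable
  have "AE x in N. e2ennreal (g x) \<noteq> \<infinity>"
    by (rule nn_integral_PInf_AE) (use pos in auto)
  moreover have "AE x in N. e2ennreal (- g x) \<noteq> \<infinity>"
    by (rule nn_integral_PInf_AE) (use neg in auto)
  ultimately have eq: "AE x in N. g x = ereal (r x)"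
  proof eventually_elim
    case (elim x)
    then show ?case by (cases "g x") (auto simp: r_def)
  qed
  have "ennreal (norm (r x)) \<le> e2ennreal (g x) + e2ennreal (- g x)" for x
    by (cases "g x") (auto simp: r_def abs_real_def ennreal_neg)
  then have "(\<integral>\<^sup>+ x. ennreal (norm (r x)) \<partial>N) \<le> (\<integral>\<^sup>+ x. e2ennreal (g x) + e2ennreal (- g x) \<partial>N)"
    by (intro nn_integral_mono)
  also have "\<dots> < \<infinity>"
    using pos neg by (simp add: nn_integral_add)
  finally have int: "integrable N r"
    by (intro integrableI_bounded) auto
  have "ext_integral N g = ereal (\<integral>x. r x \<partial>N)"
    using ext_integral_cong_AE[OF eq] ext_integral_ereal[OF int] by simp
  with int eq show thesis by (rule that)
qed

lemma nn_integral_negative_part_finite: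
  assumes "finite_measure N" and "\<And>x. ereal c \<le> g x"
  shows "(\<integral>\<^sup>+ x. e2ennreal (- g x) \<partial>N) < \<infinity>"
proof -
  interpret finite_measure N by fact
  have "e2ennreal (- g x) \<le> ennreal (- c)" for x
    using e2ennreal_mono[of "- g x" "ereal (- c)"] assms(2)[of x]
    by (metis e2ennreal_ereal ereal_minus_le_minus uminus_ereal.simps(1))
  then have "(\<integral>\<^sup>+ x. e2ennreal (- g x) \<partial>N) \<le> (\<integral>\<^sup>+ x. ennreal (- c) \<partial>N)"
    by (intro nn_integral_mono)
  also have "\<dots> < \<infinity>"
    by (simp add: ennreal_mult_eq_top_iff less_top[symmetric] emeasure_finite)
  finally show ?thesis .
qed

text \<open>
  The error \<open>e\<close> may be infinite on a null set, which is why it takes extended values. The lower bound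
  on \<open>g\<close> excludes an infinite integral of its negative part.
\<close>

lemma ext_integral_le_integral_plus:
  assumes "finite_measure N" and [measurable]: "g \<in> borel_measurable N"
    and lower: "\<And>x. ereal c \<le> g x"
    and u: "integrable N u"
    and e [measurable]: "e \<in> borel_measurable N" and e_le: "(\<integral>\<^sup>+ x. e x \<partial>N) \<le> ennreal \<epsilon>"
    and "0 \<le> \<epsilon>"
    and le: "AE x in N. g x \<le> ereal (u x) + enn2ereal (e x)"
  shows "ext_integral N g \<le> ereal ((\<integral>x. u x \<partial>N) + \<epsilon>)"
proof -
  have e_fin: "(\<integral>\<^sup>+ x. e x \<partial>N) < \<infinity>"
    using e_le by (simp add: le_less_trans)
  have AE_fin: "AE x in N. e x \<noteq> \<infinity>"
    by (rule nn_integral_PInf_AE) (use e_fin in auto)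
  define d where "d x = enn2real (e x)" for x
  have [measurable]: "d \<in> borel_measurable N"
    unfolding d_def by measurable
  have d_nonneg: "0 \<le> d x" for x by (simp add: d_def)
  have AE_d: "AE x in N. ennreal (d x) = e x"
    using AE_fin by eventually_elim (auto simp: d_def less_top)
  have d_int: "(\<integral>\<^sup>+ x. ennreal (d x) \<partial>N) = (\<integral>\<^sup>+ x. e x \<partial>N)"
    by (rule nn_integral_cong_AE) (rule AE_d)
  have d: "integrable N d"
    by (rule integrableI_bounded) (use d_int e_fin in \<open>auto simp: d_def\<close>)
  have "ennreal (\<integral>x. d x \<partial>N) = (\<integral>\<^sup>+ x. e x \<partial>N)"
    using nn_integral_eq_integral[OF d] d_int d_nonneg by simp
  then have d_le: "(\<integral>x. d x \<partial>N) \<le> \<epsilon>"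
    using e_le \<open>0 \<le> \<epsilon>\<close> by (metis ennreal_le_iff)
  have u_abs: "(\<integral>\<^sup>+ x. ennreal \<bar>u x\<bar> \<partial>N) < \<infinity>"
    using u by (simp add: integrable_iff_bounded)
  have [measurable]: "u \<in> borel_measurable N"
    using u by auto
  have g_le: "AE x in N. g x \<le> ereal (u x + d x)"
    using le AE_fin
  proof eventually_elim
    case (elim x)
    then show ?case
      by (cases "e x") (auto simp: d_def enn2ereal_ennreal)
  qed
  have "(\<integral>\<^sup>+ x. e2ennreal (g x) \<partial>N) \<le> (\<integral>\<^sup>+ x. ennreal \<bar>u x\<bar> + ennreal (d x) \<partial>N)"
  proof (rule nn_integral_mono_AE, use g_le in eventually_elim)
    case (elim x)
    have "e2ennreal (g x) \<le> ennreal (u x + d x)"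
      using e2ennreal_mono[OF elim] by simp
    also have "\<dots> \<le> ennreal (\<bar>u x\<bar> + d x)"
      by (intro ennreal_leI) auto
    finally show ?case
      using d_nonneg by (simp add: ennreal_plus)
  qed
  also have "\<dots> < \<infinity>"
    using u_abs d_int e_fin by (simp add: nn_integral_add)
  finally obtain r where r: "integrable N r" "AE x in N. g x = ereal (r x)"
    "ext_integral N g = ereal (\<integral>x. r x \<partial>N)"
    using ext_integral_real_representative[of g N]
      nn_integral_negative_part_finite[OF assms(1) lower] by auto
  have "(\<integral>x. r x \<partial>N) \<le> (\<integral>x. u x + d x \<partial>N)"
    by (rule integral_mono_AE) (use r u d g_le in auto)
  also have "\<dots> \<le> (\<integral>x. u x \<partial>N) + \<epsilon>"
    using u d d_le by simp
  finally show ?thesis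
    using r(3) by simp
qed

section \<open>Conjugates and weak duality\<close>

lemma young_inequality: "ereal (x * y - f x) \<le> convex_conjugate f y"
  unfolding convex_conjugate_def by (rule SUP_upper) simp

lemma borel_measurable_convex_conjugate [measurable]:
  "convex_conjugate f \<in> borel_measurable borel"
proof (rule borel_measurableI_greater)
  fix a :: ereal
  \<comment> \<open>A supremum of continuous functions is lower semicontinuous, so no measurability of \<open>f\<close> is needed.\<close>
  have "{y. a < convex_conjugate f y} = (\<Union>x. {y. a < ereal (x * y - f x)})"
    by (auto simp: convex_conjugate_def less_SUP_iff)
  moreover have "open {y. a < ereal (x * y - f x)}" for x
    by (intro open_Collect_less continuous_intros)
  ultimately show "{y \<in> space borel. a < convex_conjugate f y} \<in> sets borel"
    by (auto intro!: borel_open)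
qed

text \<open>
  The integrated Young inequality. The integral of \<open>f (q p)\<close> may be \<open>\<infinity>\<close>. It cannot be \<open>- \<infinity>\<close>, because
  \<open>f (q p)\<close> dominates the difference of the integrable functions \<open>q p * s p\<close> and \<open>f\<^sup>* (s p)\<close>.
\<close>

lemma integral_le_ext_integral_conjugate:
  fixes q s :: "'a \<Rightarrow> real"
  assumes "finite_measure N"
    and [measurable]: "q \<in> borel_measurable N" "s \<in> borel_measurable N" "f \<in> borel_measurable borel"
    and qs: "integrable N (\<lambda>p. q p * s p)"
    and fin: "ext_integral N (\<lambda>p. convex_conjugate f (s p)) \<noteq> \<infinity>"
  shows "ereal (\<integral>p. q p * s p \<partial>N) \<le>
    ext_integral N (\<lambda>p. ereal (f (q p))) + ext_integral N (\<lambda>p. convex_conjugate f (s p))"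
proof -
  define g where "g p = convex_conjugate f (s p)" for p
  have [measurable]: "g \<in> borel_measurable N"
    unfolding g_def by measurable
  have neg: "(\<integral>\<^sup>+ x. e2ennreal (- g x) \<partial>N) < \<infinity>"
    by (rule nn_integral_negative_part_finite[OF assms(1), where c = "- f 0"])
       (use young_inequality[of 0 _ f] in \<open>simp add: g_def\<close>)
  have pos: "(\<integral>\<^sup>+ x. e2ennreal (g x) \<partial>N) < \<infinity>"
  proof (rule ccontr)
    assume "\<not> ?thesis"
    then have "(\<integral>\<^sup>+ x. e2ennreal (g x) \<partial>N) = \<infinity>"
      by (simp add: less_top[symmetric])
    moreover have "enn2ereal (\<integral>\<^sup>+ x. e2ennreal (- g x) \<partial>N) \<noteq> \<infinity>"
      using neg by (cases "(\<integral>\<^sup>+ x. e2ennreal (- g x) \<partial>N)") (auto simp: enn2ereal_ennreal)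
    ultimately have "ext_integral N g = \<infinity>"
      by (simp add: ext_integral_def enn2ereal_top)
    with fin show False by (simp add: g_def[abs_def])
  qed
  obtain r where r: "integrable N r" "AE x in N. g x = ereal (r x)"
    "ext_integral N g = ereal (\<integral>x. r x \<partial>N)"
    using ext_integral_real_representative[of g N] pos neg by auto
  define v where "v p = f (q p)" for p
  have [measurable]: "v \<in> borel_measurable N"
    unfolding v_def by measurable
  have diff: "integrable N (\<lambda>p. q p * s p - r p)"
    using qs r by auto
  have [measurable]: "r \<in> borel_measurable N"
    using r by auto
  have v_ge: "AE p in N. q p * s p - r p \<le> v p"
    using r(2)
  proof eventually_elim
    case (elim p)
    have "ereal (q p * s p - f (q p)) \<le> ereal (r p)"
      using young_inequality[of "q p" "s p" f] elim by (simp add: g_def)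
    then show ?case by (simp add: v_def)
  qed
  have v_neg: "(\<integral>\<^sup>+ p. ennreal (- v p) \<partial>N) < \<infinity>"
  proof -
    have "(\<integral>\<^sup>+ p. ennreal (- v p) \<partial>N) \<le> (\<integral>\<^sup>+ p. ennreal (norm (q p * s p - r p)) \<partial>N)"
    proof (rule nn_integral_mono_AE, use v_ge in eventually_elim)
      case (elim p)
      then show ?case by (intro ennreal_leI) auto
    qed
    also have "\<dots> < \<infinity>"
      using diff by (simp add: integrable_iff_bounded)
    finally show ?thesis .
  qed
  show ?thesis
  proof (cases "(\<integral>\<^sup>+ p. ennreal (v p) \<partial>N) = \<infinity>")
    case True
    moreover have "enn2ereal (\<integral>\<^sup>+ x. ennreal (- v x) \<partial>N) \<noteq> \<infinity>"
      using v_neg by (cases "(\<integral>\<^sup>+ x. ennreal (- v x) \<partial>N)") (auto simp: enn2ereal_ennreal)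
    ultimately have "ext_integral N (\<lambda>p. ereal (v p)) = \<infinity>"
      by (simp add: ext_integral_def enn2ereal_top)
    then show ?thesis
      by (simp add: v_def)
  next
    case False
    then have v: "integrable N v"
      using v_neg by (simp add: real_integrable_def)
    have "(\<integral>p. q p * s p - r p \<partial>N) \<le> (\<integral>p. v p \<partial>N)"
      by (rule integral_mono_AE) (use diff v v_ge in auto)
    then have "(\<integral>p. q p * s p \<partial>N) \<le> (\<integral>p. v p \<partial>N) + (\<integral>p. r p \<partial>N)"
      using qs r by simp
    then show ?thesis
      using ext_integral_ereal[OF v] r(3) by (simp add: v_def g_def[abs_def])
  qed
qed

section \<open>Quantiles as random variables on the unit interval\<close>

abbreviation unit_lborel :: "real measure" where
  "unit_lborel \<equiv> restrict_space lborel {0<..<1}"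

lemma prob_space_unit_lborel: "prob_space unit_lborel"
  by (auto simp: space_restrict_space emeasure_restrict_space intro!: prob_spaceI)

lemma integral_unit_lborel:
  fixes f :: "real \<Rightarrow> real"
  shows "(\<integral>x. f x \<partial>unit_lborel) = (LBINT x:{0<..<1}. f x)"
  unfolding set_lebesgue_integral_def by (rule integral_restrict_space) simp

lemma integrable_unit_lborel:
  fixes f :: "real \<Rightarrow> real"
  shows "integrable unit_lborel f \<longleftrightarrow> set_integrable lborel {0<..<1} f"
  unfolding set_integrable_def by (rule integrable_restrict_space) simp

context
  fixes M :: "'a measure" and Y :: "'a \<Rightarrow> real"
  assumes M: "prob_space M" and Y [measurable]: "Y \<in> borel_measurable M"
begin

interpretation prob_space M by (rule M)

interpretation Y: cdf_distribution "distr M borel Y"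
  unfolding cdf_distribution_def by (rule real_distribution_distr[OF Y])

lemma quantile_eq_pseudoinverse: "quantile M Y = Y.I"
proof -
  have "cdf (distr M borel Y) y = \<P>(\<omega> in M. Y \<omega> \<le> y)" for y
    unfolding cdf_def by (subst measure_distr) (auto intro!: arg_cong[where f = "measure M"])
  then show ?thesis
    by (auto simp: quantile_def)
qed

lemma quantile_le_iff:
  assumes "0 < \<alpha>" "\<alpha> < 1"
  shows "quantile M Y \<alpha> \<le> y \<longleftrightarrow> \<alpha> \<le> cdf (distr M borel Y) y"
  unfolding quantile_eq_pseudoinverse by (rule Y.pseudoinverse[OF assms, symmetric])

lemma borel_measurable_quantile: "quantile M Y \<in> borel_measurable unit_lborel"
proof -
  have sets_eq: "sets unit_lborel = sets (restrict_space borel {0<..<1})"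
    by (rule sets_restrict_space_cong) simp
  show ?thesis
    unfolding quantile_eq_pseudoinverse measurable_cong_sets[OF sets_eq refl]
    by (rule Y.measurable_CI)
qed

lemma distr_quantile: "distr unit_lborel borel (quantile M Y) = distr M borel Y"
  unfolding quantile_eq_pseudoinverse by (rule Y.distr_I_eq_M)

lemma mono_cdf_distr: "mono (cdf (distr M borel Y))"
  by (rule Y.mono)

end

section \<open>Approximate minimizers\<close>

lemma truncated_tail_small:
  fixes g :: "'a \<Rightarrow> real"
  assumes g: "integrable N g" and "0 < \<epsilon>"
  obtains H :: real where "0 \<le> H" "(\<integral>\<^sup>+ x. ennreal (g x - H) \<partial>N) \<le> ennreal \<epsilon>"
proof -
  have [measurable]: "g \<in> borel_measurable N" using g by auto
  have "(\<lambda>n. \<integral>\<^sup>+ x. ennreal (g x - real n) \<partial>N) \<longlonglongrightarrow> (\<integral>\<^sup>+ x. 0 \<partial>N)"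
  proof (rule nn_integral_dominated_convergence[where w = "\<lambda>x. ennreal (norm (g x))"])
    show "(\<integral>\<^sup>+ x. ennreal (norm (g x)) \<partial>N) < \<infinity>"
      using g by (simp add: integrable_iff_bounded)
    show "AE x in N. ennreal (g x - real j) \<le> ennreal (norm (g x))" for j
      by (auto intro!: ennreal_leI)
    show "AE x in N. (\<lambda>n. ennreal (g x - real n)) \<longlonglongrightarrow> 0"
    proof (rule AE_I2, rule tendsto_eventually)
      fix x
      show "\<forall>\<^sub>F n in sequentially. ennreal (g x - real n) = 0"
        using eventually_ge_at_top[of "nat \<lceil>g x\<rceil>"]
      proof eventually_elim
        case (elim n)
        then have "g x \<le> real n" by linarith
        then show ?case by (simp add: ennreal_neg)
      qed
    qed
  qed auto
  moreover have "0 < ennreal \<epsilon>" using \<open>0 < \<epsilon>\<close> by simp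
  ultimately have "\<forall>\<^sub>F n in sequentially. (\<integral>\<^sup>+ x. ennreal (g x - real n) \<partial>N) < ennreal \<epsilon>"
    by (intro order_tendstoD(2)[where y = 0]) auto
  then obtain n where "(\<integral>\<^sup>+ x. ennreal (g x - real n) \<partial>N) < ennreal \<epsilon>"
    by (auto simp: eventually_sequentially)
  then show thesis
    by (intro that[of "real n"]) auto
qed

text \<open>
  If \<open>t\<close> separates the values of the monotone function \<open>S\<close> before and after \<open>q\<close>, then it is a
  subgradient at \<open>q\<close> of the primitive of \<open>S\<close>. To the left of \<open>- C\<close> the integral is over an empty
  interval, so the primitive is constant there, and the inequality persists because \<open>t\<close> is
  nonnegative.
\<close>

lemma integral_supporting_line:
  fixes S :: "real \<Rightarrow> real"
  assumes "mono S" and "0 \<le> t" and q: "- C \<le> q"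
    and below: "\<And>y. y < q \<Longrightarrow> S y \<le> t" and above: "\<And>y. q \<le> y \<Longrightarrow> t \<le> S y"
  shows "integral {- C..q} S + t * (x - q) \<le> integral {- C..x} S"
proof -
  have int: "S integrable_on {a..b}" for a b
    by (rule integrable_on_mono_on) (use \<open>mono S\<close> in \<open>simp add: mono_def mono_on_def\<close>)
  have const: "((\<lambda>_. t) has_integral t * (b - a)) {a..b}" if "a \<le> b" for a b
    using has_integral_const_real[of t a b] that by (simp add: mult.commute)
  have left: "integral {- C..q} S + t * (z - q) \<le> integral {- C..z} S"
    if z: "- C \<le> z" "z \<le> q" for z
  proof -
    have "integral {- C..q} S = integral {- C..z} S + integral {z..q} S"
      using Henstock_Kurzweil_Integration.integral_combine[OF z int] by simp
    moreover have "integral {z..q} S \<le> t * (q - z)"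
    proof -
      \<comment> \<open>The value of \<open>S\<close> at \<open>q\<close> may exceed \<open>t\<close>, but a single point does not affect the integral.\<close>
      define S' where "S' y = (if y = q then t else S y)" for y
      have "(S' has_integral integral {z..q} S) {z..q}"
        by (rule has_integral_spike_finite[of "{q}" _ _ S])
           (use int in \<open>auto simp: S'_def has_integral_integral\<close>)
      then show ?thesis
        by (rule has_integral_le[OF _ const[OF z(2)]]) (auto simp: S'_def less_imp_le below)
    qed
    ultimately show ?thesis by (simp add: algebra_simps)
  qed
  consider "x < - C" | "- C \<le> x" "x \<le> q" | "q \<le> x" by linarith
  then show ?thesis
  proof cases
    case 1
    have "t * (x - q) \<le> t * (- C - q)"
      using 1 \<open>0 \<le> t\<close> by (intro mult_left_mono) auto
    then show ?thesis
      using left[of "- C"] q 1 by simp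
  next
    case 2
    then show ?thesis by (rule left)
  next
    case 3
    have "integral {- C..x} S = integral {- C..q} S + integral {q..x} S"
      using Henstock_Kurzweil_Integration.integral_combine[OF q 3 int] by simp
    moreover have "t * (x - q) \<le> integral {q..x} S"
      by (rule has_integral_le[OF const[OF 3] integrable_integral[OF int]]) (simp add: above)
    ultimately show ?thesis by simp
  qed
qed

text \<open>
  The step function with value \<open>H k\<close> on the interval \<open>(C + k - 1, C + k]\<close> for \<open>k \<ge> 1\<close>, and \<open>0\<close> up
  to \<open>C\<close>. The value \<open>H 0\<close> is not used here; it encodes the truncation level \<open>H 0 / (2 * C)\<close> of the
  density.
\<close>

definition penalty :: "real \<Rightarrow> (nat \<Rightarrow> real) \<Rightarrow> real \<Rightarrow> real" where
  "penalty C H x = (if x \<le> C then 0 else H (nat \<lceil>x - C\<rceil>))"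

text \<open>
  A primitive of \<open>S\<close> on \<open>[- C, C]\<close>, extended by constants on both sides, plus the penalty. The result
  need not be convex.
\<close>

definition primitive_with_penalty ::
    "real \<Rightarrow> (real \<Rightarrow> real) \<Rightarrow> (nat \<Rightarrow> real) \<Rightarrow> real \<Rightarrow> real" where
  "primitive_with_penalty C S H x = integral {- C..min x C} S + penalty C H x"

lemma mono_integral_atLeastAtMost:
  fixes S :: "real \<Rightarrow> real"
  assumes "mono S" and nonneg: "\<And>y. 0 \<le> S y"
  shows "mono (\<lambda>x. integral {a..x} S)"
proof (rule monoI)
  fix x y :: real assume "x \<le> y"
  have int: "S integrable_on {a..b}" for b
    by (rule integrable_on_mono_on) (use \<open>mono S\<close> in \<open>simp add: mono_def mono_on_def\<close>)
  show "integral {a..x} S \<le> integral {a..y} S"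
    using \<open>x \<le> y\<close> by (intro integral_subset_le int) (auto simp: nonneg)
qed

lemma borel_measurable_primitive_with_penalty:
  assumes "mono S" and "\<And>y. 0 \<le> S y"
  shows "primitive_with_penalty C S H \<in> borel_measurable borel"
proof -
  have [measurable]: "(\<lambda>x. integral {- C..x} S) \<in> borel_measurable borel"
    by (intro borel_measurable_mono mono_integral_atLeastAtMost assms)
  have [measurable]: "(\<lambda>x. integral {- C..min x C} S) \<in> borel_measurable borel"
    by (rule measurable_compose[of "\<lambda>x. min x C" borel borel "\<lambda>x. integral {- C..x} S"]) measurable
  have [measurable]: "(\<lambda>x. H (nat \<lceil>x - C\<rceil>)) \<in> borel_measurable borel"
    by measurable
  show ?thesis
    unfolding primitive_with_penalty_def[abs_def] penalty_def[abs_def] by measurable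
qed

text \<open>
  Near equality in the Young inequality at a point \<open>q\<close> where the truncated slope \<open>t\<close>, rather than \<open>s\<close>
  itself, is a subgradient of the primitive. In the supremum defining the conjugate, the points
  \<open>x \<le> C\<close> are controlled by the term \<open>k = 0\<close> of the error, which equals \<open>2 * C * (s - t)\<close>,
  and the points of the step \<open>(C + k - 1, C + k]\<close> by the term \<open>k\<close>.
\<close>

lemma convex_conjugate_primitive_with_penalty_le:
  fixes S :: "real \<Rightarrow> real" and s :: real
  assumes "mono S" and "0 < C" and q: "- C \<le> q" "q \<le> C" and "0 \<le> s" and "0 \<le> H 0"
    and t: "t = min s (H 0 / (2 * C))"
    and below: "\<And>y. y < q \<Longrightarrow> S y \<le> t" and above: "\<And>y. q \<le> y \<Longrightarrow> t \<le> S y"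
  shows "convex_conjugate (primitive_with_penalty C S H) s \<le>
    ereal (q * s - primitive_with_penalty C S H q)
      + enn2ereal (\<Sum>k. ennreal ((2 * C + real k) * s - H k))" (is "_ \<le> ereal ?a + enn2ereal ?e")
proof -
  have "0 \<le> t" "t \<le> s"
    using \<open>0 \<le> s\<close> \<open>0 \<le> H 0\<close> \<open>0 < C\<close> by (auto simp: t)
  have line: "integral {- C..q} S + t * (x - q) \<le> integral {- C..x} S" for x
    using integral_supporting_line[OF \<open>mono S\<close> \<open>0 \<le> t\<close> q(1) below above] by blast
  have fq: "primitive_with_penalty C S H q = integral {- C..q} S"
    using q by (simp add: primitive_with_penalty_def penalty_def)
  have bound: "x * s - primitive_with_penalty C S H x
      \<le> ?a + max 0 ((2 * C + real (nat \<lceil>x - C\<rceil>)) * s - H (nat \<lceil>x - C\<rceil>))" for x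
  proof (cases "x \<le> C")
    case True
    then have k: "nat \<lceil>x - C\<rceil> = 0" by (simp add: ceiling_le_zero)
    have "x * (s - t) \<le> C * (s - t)" "- q * (s - t) \<le> C * (s - t)"
      using True \<open>t \<le> s\<close> q by (intro mult_right_mono; simp)+
    moreover have "2 * C * (s - t) = max 0 (2 * C * s - H 0)"
      using \<open>0 < C\<close> by (auto simp: t min_def max_def field_simps)
    ultimately show ?thesis
      using line[of x] True
      by (simp add: fq k) (simp add: primitive_with_penalty_def penalty_def algebra_simps)
  next
    case False
    define k where "k = nat \<lceil>x - C\<rceil>"
    have "x \<le> C + real k"
      using False by (simp add: k_def) linarith
    then have "x * s \<le> (C + real k) * s"
      using \<open>0 \<le> s\<close> by (intro mult_right_mono)
    moreover have "- q * (s - t) \<le> C * (s - t)"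
      using \<open>t \<le> s\<close> q by (intro mult_right_mono) auto
    moreover have "0 \<le> C * t" using \<open>0 < C\<close> \<open>0 \<le> t\<close> by simp
    ultimately have "x * s - (integral {- C..C} S + H k)
        \<le> q * s - integral {- C..q} S + ((2 * C + real k) * s - H k)"
      using line[of C] by (simp add: algebra_simps)
    then show ?thesis
      using False unfolding fq k_def[symmetric]
      by (simp add: primitive_with_penalty_def penalty_def k_def[symmetric])
  qed
  have e_ge: "ereal (max 0 ((2 * C + real k) * s - H k)) \<le> enn2ereal ?e" for k
  proof -
    have "ennreal ((2 * C + real k) * s - H k) \<le> ?e"
      using sum_le_suminf[of "\<lambda>k. ennreal ((2 * C + real k) * s - H k)" "{k}"] by simp
    then show ?thesis
      by (simp add: less_eq_ennreal.rep_eq ennreal.rep_eq max_def zero_ereal_def[symmetric] enn2ereal_nonneg split: if_splits)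
  qed
  have "ereal (x * s - primitive_with_penalty C S H x) \<le> ereal ?a + enn2ereal ?e" for x
  proof -
    define m where "m = max 0 ((2 * C + real (nat \<lceil>x - C\<rceil>)) * s - H (nat \<lceil>x - C\<rceil>))"
    have "ereal (x * s - primitive_with_penalty C S H x) \<le> ereal ?a + ereal m"
      using bound[of x, folded m_def] by simp
    also have "\<dots> \<le> ereal ?a + enn2ereal ?e"
      unfolding m_def by (intro add_left_mono e_ge)
    finally show ?thesis .
  qed
  then show ?thesis
    unfolding convex_conjugate_def by (intro SUP_least)
qed

context
  fixes M :: "'a measure" and Y :: "'a \<Rightarrow> real" and \<sigma> :: "real \<Rightarrow> real" and C :: real
  assumes M: "prob_space M" and Y [measurable]: "Y \<in> borel_measurable M"
    and \<sigma>: "spectral_density \<sigma>"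
    and C: "0 < C" "AE \<omega> in M. \<bar>Y \<omega>\<bar> \<le> C"
begin

lemma AE_quantile_bounded: "AE p in unit_lborel. \<bar>quantile M Y p\<bar> \<le> C"
proof -
  have "AE y in distr M borel Y. \<bar>y\<bar> \<le> C"
    using C(2) by (subst AE_distr_iff) auto
  then show ?thesis
    unfolding distr_quantile[OF M Y, symmetric]
    by (subst (asm) AE_distr_iff) (auto intro: borel_measurable_quantile[OF M Y])
qed

lemma integrable_spectral_density: "integrable unit_lborel \<sigma>"
  using \<sigma> by (simp add: spectral_density_def integrable_unit_lborel)

lemma integrable_quantile_times_density: "integrable unit_lborel (\<lambda>p. quantile M Y p * \<sigma> p)"
proof (rule Bochner_Integration.integrable_bound)
  show "integrable unit_lborel (\<lambda>p. C * \<sigma> p)"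
    using integrable_spectral_density by simp
  show "(\<lambda>p. quantile M Y p * \<sigma> p) \<in> borel_measurable unit_lborel"
    using borel_measurable_quantile[OF M Y] integrable_spectral_density by measurable
  show "AE p in unit_lborel. norm (quantile M Y p * \<sigma> p) \<le> norm (C * \<sigma> p)"
    using AE_quantile_bounded
    by eventually_elim (use C(1) in \<open>auto simp: abs_mult intro!: mult_right_mono\<close>)
qed

lemma spectral_risk_eq: "spectral_risk M \<sigma> Y = (\<integral>p. quantile M Y p * \<sigma> p \<partial>unit_lborel)"
  by (simp add: spectral_risk_def integral_unit_lborel)

lemma ext_integral_compose_quantile:
  assumes [measurable]: "f \<in> borel_measurable borel"
  shows "ext_integral M (\<lambda>\<omega>. ereal (f (Y \<omega>))) =
    ext_integral unit_lborel (\<lambda>p. ereal (f (quantile M Y p)))"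
proof -
  have "ext_integral M (\<lambda>\<omega>. ereal (f (Y \<omega>))) = ext_integral (distr M borel Y) (\<lambda>y. ereal (f y))"
    by (rule ext_integral_distr[symmetric]) measurable
  also have "\<dots> = ext_integral unit_lborel (\<lambda>p. ereal (f (quantile M Y p)))"
    unfolding distr_quantile[OF M Y, symmetric]
    by (rule ext_integral_distr[OF borel_measurable_quantile[OF M Y]]) measurable
  finally show ?thesis .
qed

lemma spectral_risk_le_conjugate_objective:
  assumes f: "f \<in> borel_measurable borel"
  shows "ereal (spectral_risk M \<sigma> Y) \<le> conjugate_objective M \<sigma> Y f"
proof -
  interpret U: prob_space unit_lborel by (rule prob_space_unit_lborel)
  have "\<sigma> \<in> borel_measurable unit_lborel"
    using integrable_spectral_density by auto
  then show ?thesis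
    using integral_le_ext_integral_conjugate[OF U.finite_measure_axioms
        borel_measurable_quantile[OF M Y] _ f integrable_quantile_times_density]
    by (simp add: conjugate_objective_def Let_def spectral_risk_eq ext_integral_compose_quantile[OF f])
qed

lemma exists_approximate_minimizer:
  assumes "0 < \<epsilon>"
  shows "\<exists>f\<in>borel_measurable borel.
    conjugate_objective M \<sigma> Y f \<le> ereal (spectral_risk M \<sigma> Y + \<epsilon>)"
proof -
  interpret U: prob_space unit_lborel by (rule prob_space_unit_lborel)
  let ?q = "quantile M Y" and ?F = "cdf (distr M borel Y)"
  note [measurable] = borel_measurable_quantile[OF M Y]
  have \<sigma>_nonneg: "0 \<le> \<sigma> p" if "0 < p" "p < 1" for p
    using \<sigma> that by (auto simp: spectral_density_def)
  have \<sigma>_mono: "\<sigma> p \<le> \<sigma> p'" if "0 < p" "p \<le> p'" "p' < 1" for p p'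
    using \<sigma> that by (auto simp: spectral_density_def intro: mono_onD)
  have [measurable]: "\<sigma> \<in> borel_measurable unit_lborel"
    using integrable_spectral_density by auto
  have "\<exists>h\<ge>0. (\<integral>\<^sup>+ p. ennreal ((2 * C + real k) * \<sigma> p - h) \<partial>unit_lborel)
      \<le> ennreal (\<epsilon> * (1 / 2) ^ Suc k)" for k
    using truncated_tail_small[of unit_lborel "\<lambda>p. (2 * C + real k) * \<sigma> p" "\<epsilon> * (1 / 2) ^ Suc k"]
      integrable_spectral_density \<open>0 < \<epsilon>\<close> by (metis Bochner_Integration.integrable_mult_right
        mult_pos_pos half_gt_zero zero_less_one zero_less_power)
  then obtain H where H0: "\<And>k. 0 \<le> H k" and
    H: "\<And>k. (\<integral>\<^sup>+ p. ennreal ((2 * C + real k) * \<sigma> p - H k) \<partial>unit_lborel)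
      \<le> ennreal (\<epsilon> * (1 / 2) ^ Suc k)"
    by metis
  \<comment> \<open>With this level, \<open>2 * C * (\<sigma> p - min (\<sigma> p) n)\<close> is the positive part of
    \<open>2 * C * \<sigma> p - H 0\<close>.\<close>
  define n where "n = H 0 / (2 * C)"
  have "0 \<le> n" using H0 C(1) by (simp add: n_def)
  \<comment> \<open>The truncated density, extended monotonically to the values \<open>0\<close> and \<open>1\<close> that the distribution
    function may take.\<close>
  define \<tau> where "\<tau> p = (if p \<le> 0 then 0 else if 1 \<le> p then n else min (\<sigma> p) n)" for p
  have \<tau>_nonneg: "0 \<le> \<tau> p" for p
    using \<open>0 \<le> n\<close> \<sigma>_nonneg by (auto simp: \<tau>_def)
  have \<tau>_mono: "\<tau> p \<le> \<tau> p'" if "p \<le> p'" for p p'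
    using that \<open>0 \<le> n\<close> \<sigma>_nonneg[of p'] \<sigma>_mono[of p p'] by (auto simp: \<tau>_def min_def)
  define S where "S y = \<tau> (?F y)" for y
  have S_nonneg: "0 \<le> S y" for y
    by (simp add: S_def \<tau>_nonneg)
  have "mono S"
    using mono_cdf_distr[OF M Y] by (auto simp: S_def mono_def intro!: \<tau>_mono)
  define f where "f = primitive_with_penalty C S H"
  have f [measurable]: "f \<in> borel_measurable borel"
    unfolding f_def by (rule borel_measurable_primitive_with_penalty[OF \<open>mono S\<close> S_nonneg])
  have fq_bounded: "AE p in unit_lborel. norm (f (?q p)) \<le> integral {- C..C} S"
    using AE_quantile_bounded
  proof eventually_elim
    case (elim p)
    note mono_int = mono_integral_atLeastAtMost[OF \<open>mono S\<close> S_nonneg, THEN monoD]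
    have "integral {- C..?q p} S \<le> integral {- C..C} S"
      "integral {- C..- C} S \<le> integral {- C..?q p} S"
      using elim by (intro mono_int; linarith)+
    moreover have "?q p \<le> C" using elim by simp
    ultimately show ?case
      by (simp add: f_def primitive_with_penalty_def penalty_def)
  qed
  have fq: "integrable unit_lborel (\<lambda>p. f (?q p))"
    by (rule U.integrable_const_bound[OF fq_bounded])
       (rule measurable_compose[OF borel_measurable_quantile[OF M Y] f])
  define e where "e p = (\<Sum>k. ennreal ((2 * C + real k) * \<sigma> p - H k))" for p
  have [measurable]: "e \<in> borel_measurable unit_lborel"
    unfolding e_def by measurable
  have e_le: "(\<integral>\<^sup>+ p. e p \<partial>unit_lborel) \<le> ennreal \<epsilon>"
  proof -
    have "(\<integral>\<^sup>+ p. e p \<partial>unit_lborel)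
        = (\<Sum>k. \<integral>\<^sup>+ p. ennreal ((2 * C + real k) * \<sigma> p - H k) \<partial>unit_lborel)"
      unfolding e_def by (rule nn_integral_suminf) measurable
    also have "\<dots> \<le> (\<Sum>k. ennreal (\<epsilon> * (1 / 2) ^ Suc k))"
      by (intro suminf_le H) auto
    also have "\<dots> = ennreal \<epsilon>"
      using sums_mult[OF power_half_series, of \<epsilon>] \<open>0 < \<epsilon>\<close> by (intro suminf_ennreal_eq) auto
    finally show ?thesis .
  qed
  have conj_le: "AE p in unit_lborel.
      convex_conjugate f (\<sigma> p) \<le> ereal (?q p * \<sigma> p - f (?q p)) + enn2ereal (e p)"
    using AE_quantile_bounded AE_space
  proof eventually_elim
    case (elim p)
    then have p: "0 < p" "p < 1" by (auto simp: space_restrict_space)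
    have t: "\<tau> p = min (\<sigma> p) (H 0 / (2 * C))"
      using p by (simp add: \<tau>_def n_def)
    have below: "S y \<le> \<tau> p" if "y < ?q p" for y
      using quantile_le_iff[OF M Y p, of y] that by (auto simp: S_def intro!: \<tau>_mono)
    have above: "\<tau> p \<le> S y" if "?q p \<le> y" for y
      using quantile_le_iff[OF M Y p, of y] that by (auto simp: S_def intro!: \<tau>_mono)
    show ?case
      unfolding f_def e_def
      by (rule convex_conjugate_primitive_with_penalty_le[where t = "\<tau> p"])
         (use \<open>mono S\<close> C(1) H0[of 0] t below above elim p \<sigma>_nonneg[OF p] in auto)
  qed
  have diff: "integrable unit_lborel (\<lambda>p. ?q p * \<sigma> p - f (?q p))"
    using integrable_quantile_times_density fq by simp
  have J: "ext_integral unit_lborel (\<lambda>p. convex_conjugate f (\<sigma> p))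
      \<le> ereal ((\<integral>p. ?q p * \<sigma> p - f (?q p) \<partial>unit_lborel) + \<epsilon>)"
  proof (rule ext_integral_le_integral_plus[where c = "- f 0" and e = e])
    show "ereal (- f 0) \<le> convex_conjugate f (\<sigma> p)" for p
      using young_inequality[of 0 "\<sigma> p" f] by simp
    show "(\<lambda>p. convex_conjugate f (\<sigma> p)) \<in> borel_measurable unit_lborel"
      by measurable
    show "finite_measure unit_lborel" by (rule U.finite_measure_axioms)
    show "e \<in> borel_measurable unit_lborel" by measurable
    show "0 \<le> \<epsilon>" using \<open>0 < \<epsilon>\<close> by simp
    show "integrable unit_lborel (\<lambda>p. ?q p * \<sigma> p - f (?q p))" by (rule diff)
    show "(\<integral>\<^sup>+ p. e p \<partial>unit_lborel) \<le> ennreal \<epsilon>" by (rule e_le)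
    show "AE p in unit_lborel.
        convex_conjugate f (\<sigma> p) \<le> ereal (?q p * \<sigma> p - f (?q p)) + enn2ereal (e p)"
      by (rule conj_le)
  qed
  have "ext_integral unit_lborel (\<lambda>p. convex_conjugate f (\<sigma> p)) \<noteq> \<infinity>"
    using J by force
  then have "conjugate_objective M \<sigma> Y f
      = ereal (\<integral>p. f (?q p) \<partial>unit_lborel)
        + ext_integral unit_lborel (\<lambda>p. convex_conjugate f (\<sigma> p))"
    by (simp add: conjugate_objective_def ext_integral_compose_quantile[OF f]
        ext_integral_ereal[OF fq])
  also have "\<dots> \<le> ereal (\<integral>p. f (?q p) \<partial>unit_lborel)
        + ereal ((\<integral>p. ?q p * \<sigma> p - f (?q p) \<partial>unit_lborel) + \<epsilon>)"
    by (intro add_left_mono J)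
  also have "\<dots> = ereal (spectral_risk M \<sigma> Y + \<epsilon>)"
    using integrable_quantile_times_density fq by (simp add: spectral_risk_eq)
  finally show ?thesis
    using f by blast
qed

end

theorem theorem16:
  fixes M :: "'a measure" and \<sigma> :: "real \<Rightarrow> real" and Y :: "'a \<Rightarrow> real"
  assumes "prob_space M"
    and "spectral_density \<sigma>"
    and "Y \<in> borel_measurable M"
    and "\<exists>C. AE \<omega> in M. \<bar>Y \<omega>\<bar> \<le> C"
  shows "ereal (spectral_risk M \<sigma> Y) =
    (INF f\<in>borel_measurable borel. conjugate_objective M \<sigma> Y f)"
proof -
  obtain C' where C': "AE \<omega> in M. \<bar>Y \<omega>\<bar> \<le> C'"
    using assms(4) by blast
  \<comment> \<open>The truncation level is obtained by dividing by the bound, so the bound is made positive.\<close>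
  define C where "C = max 1 C'"
  have C: "0 < C" "AE \<omega> in M. \<bar>Y \<omega>\<bar> \<le> C"
    using C' by (auto simp: C_def)
  show ?thesis
  proof (rule antisym)
    show "ereal (spectral_risk M \<sigma> Y) \<le> (INF f\<in>borel_measurable borel. conjugate_objective M \<sigma> Y f)"
      by (intro INF_greatest spectral_risk_le_conjugate_objective[OF assms(1,3,2) C])
    show "(INF f\<in>borel_measurable borel. conjugate_objective M \<sigma> Y f) \<le> ereal (spectral_risk M \<sigma> Y)"
    proof (rule ereal_le_epsilon2)
      fix \<epsilon> :: real assume "0 < \<epsilon>"
      then obtain f where "f \<in> borel_measurable borel"
        "conjugate_objective M \<sigma> Y f \<le> ereal (spectral_risk M \<sigma> Y + \<epsilon>)"
        using exists_approximate_minimizer[OF assms(1,3,2) C] by blast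
      then show "(INF f\<in>borel_measurable borel. conjugate_objective M \<sigma> Y f)
          \<le> ereal (spectral_risk M \<sigma> Y) + ereal \<epsilon>"
        by (simp add: INF_lower2)
    qed
  qed
qed

end
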